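(* There exist an absolute constant $c>0$ and an integer $d_0$ such that for every integer $d\ge d_0$, every $d$-dimensional rectilinear drawing of $K_{2d}^d$ whose $2d$ vertices are not in convex position in $\mathbb{R}^d$ has at least $c\,2^d d^{3/2}$ crossing pairs of hyperedges; i.e., the number of crossing pairs is $\Omega(2^d d^{3/2})$.
   Context: $K_{2d}^d$ denotes the complete $d$-uniform hypergraph on $2d$ vertices. A $d$-dimensional rectilinear drawing of it places the vertices at points in general position in $\mathbb{R}^d$ (no $d+1$ on a common affine hyperplane) and draws each hyperedge as the $(d-1)$-simplex spanned by its $d$ vertices. Two hyperedges form a crossing pair if they have no common vertex and their simplices share a point of their relative interiors. A finite point set $V$ is in convex position if no point of $V$ is a convex combination of the other points of $V$. Asymptotic notation is as $d\to\infty$. *)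

theory Defs
  imports "HOL-Analysis.Analysis" "HOL-Analysis.Finite_Function_Topology"
begin

text \<open>
  The dimension is quantified inside the statement, so it cannot be a type parameter.
  We realise \<open>\<real>\<^sup>d\<close> as the \<open>d\<close>-dimensional coordinate subspace, spanned by the coordinates
  below \<open>d\<close>, of the normed space of finitely supported real sequences. The norm there is the
  sum of the absolute values of the coordinates, so the subspace carries the usual topology
  of \<open>\<real>\<^sup>d\<close>; convex hulls, affine hulls and relative interiors of its subsets
  therefore have their usual meaning.
\<close>

type_synonym point = "nat \<Rightarrow>\<^sub>0 real"

definition Rn :: "nat \<Rightarrow> point set" where
  "Rn d = {x. Poly_Mapping.keys x \<subseteq> {..<d}}"

definition hyperplane :: "nat \<Rightarrow> point set \<Rightarrow> bool" where
  "hyperplane d H \<longleftrightarrow>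
     (\<exists>(a :: nat \<Rightarrow> real) b. (\<exists>i<d. a i \<noteq> 0) \<and>
        H = {x \<in> Rn d. (\<Sum>i<d. a i * Poly_Mapping.lookup x i) = b})"

definition general_position :: "nat \<Rightarrow> point set \<Rightarrow> bool" where
  "general_position d S \<longleftrightarrow>
     S \<subseteq> Rn d \<and>
     \<not> (\<exists>W H. W \<subseteq> S \<and> card W = d + 1 \<and> hyperplane d H \<and> W \<subseteq> H)"

definition convex_position :: "point set \<Rightarrow> bool" where
  "convex_position S \<longleftrightarrow> (\<forall>v\<in>S. v \<notin> convex hull (S - {v}))"

definition complete_hyperedges :: "nat \<Rightarrow> 'v set \<Rightarrow> 'v set set" where
  "complete_hyperedges k U = {e. e \<subseteq> U \<and> card e = k}"

definition rectilinear_drawing :: "nat \<Rightarrow> 'v set \<Rightarrow> ('v \<Rightarrow> point) \<Rightarrow> bool" where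
  "rectilinear_drawing d U p \<longleftrightarrow> inj_on p U \<and> general_position d (p ` U)"

definition simplex_of :: "('v \<Rightarrow> point) \<Rightarrow> 'v set \<Rightarrow> point set" where
  "simplex_of p e = convex hull (p ` e)"

definition crossing :: "('v \<Rightarrow> point) \<Rightarrow> 'v set \<Rightarrow> 'v set \<Rightarrow> bool" where
  "crossing p e f \<longleftrightarrow>
     e \<inter> f = {} \<and> rel_interior (simplex_of p e) \<inter> rel_interior (simplex_of p f) \<noteq> {}"

text \<open>Crossing pairs are unordered, hence sets \<open>{e, f}\<close>.\<close>

definition crossing_pairs :: "nat \<Rightarrow> 'v set \<Rightarrow> ('v \<Rightarrow> point) \<Rightarrow> 'v set set set" where
  "crossing_pairs k U p =
     {{e, f} | e f. e \<in> complete_hyperedges k U \<and> f \<in> complete_hyperedges k U \<and> crossing p e f}"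

end

theory Submission
  imports Defs "HOL-Real_Asymp.Real_Asymp"
begin

text \<open>
  Let \<open>D\<close> be the space of affine dependencies of the \<open>2d\<close> points; it has dimension \<open>d - 1\<close>, and by
  general position any \<open>d - 1\<close> coordinates determine an element of \<open>D\<close>. Crossing pairs are the
  complementary pairs of balanced cells, i.e. of sign patterns with \<open>d\<close> positive and \<open>d\<close> negative
  entries that occur in \<open>D\<close>. We count incidences between balanced cells and rays of \<open>D\<close>, a ray being
  given by its \<open>d - 2\<close> vanishing coordinates.

  Every \<open>d - 3\<close> coordinates cut out a plane in \<open>D\<close>; rotating in it from a vector to its negative, one
  passes a ray whose \<open>d + 2\<close> nonzero entries are split evenly. The zeros of such a ray can be perturbed
  to arbitrary signs, so it lies on at least \<open>2 ^ (d - 2) / d\<close> balanced cells. Conversely, by the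
  halving argument of the asymptotic upper bound theorem, a cell has at most
  \<open>8 * d\<^sup>2\<close> times as many rays as there are sets of at most \<open>(d - 2) / 2\<close> coordinates. Since
  \<open>2d choose (d - 3)\<close> exceeds that number of sets by an exponential factor, there are exponentially more
  than \<open>2 ^ d\<close> crossing pairs.
\<close>

section \<open>Cells and rays of a generic subspace\<close>

text \<open>A discrete intermediate value argument: the count of positive entries changes only where
  some entry vanishes, and since entries vanish one at a time it cannot jump over
  \<open>s\<close>.\<close>

lemma segment_meets_balanced:
  fixes x y :: "'a \<Rightarrow> real"
  assumes I: "finite I" and s: "s < card I"
    and one: "\<And>t. card {i \<in> I. (1 - t) * x i + t * y i = 0} \<le> 1"
    and x: "card {i \<in> I. 0 < x i} \<le> s" and y: "s < card {i \<in> I. 0 < y i}"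
  shows "\<exists>t\<in>{0..1}. card {i \<in> I. (1 - t) * x i + t * y i = 0} = 1 \<and>
    card {i \<in> I. 0 < (1 - t) * x i + t * y i} = s"
proof -
  let ?f = "\<lambda>t i. (1 - t) * x i + t * y i"
  let ?P = "\<lambda>t. {i \<in> I. 0 < ?f t i}" and ?N = "\<lambda>t. {i \<in> I. ?f t i < 0}" and ?Z = "\<lambda>t. {i \<in> I. ?f t i = 0}"
  have total: "card (?P t) + card (?N t) + card (?Z t) = card I" for t
  proof -
    have "card I = card ((?P t \<union> ?N t) \<union> ?Z t)"
      by (rule arg_cong[of _ _ card]) auto
    also have "\<dots> = card (?P t \<union> ?N t) + card (?Z t)"
      using I by (intro card_Un_disjoint) auto
    also have "card (?P t \<union> ?N t) = card (?P t) + card (?N t)"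
      using I by (intro card_Un_disjoint) auto
    finally show ?thesis by simp
  qed
  \<comment> \<open>The thresholds \<open>s + 1\<close> for positive and \<open>card I - s\<close>
    for negative entries add up to more than \<open>card I\<close>, so \<open>A\<close> and
    \<open>B\<close> are disjoint. Outside both, at least one entry is left over and must be
    zero.\<close>
  define A where "A = {t. s < card (?P t)}"
  define B where "B = {t. card I - Suc s < card (?N t)}"
  \<comment> \<open>Written as a finite union of finite intersections of open half-lines or similar
    open sets, \<open>A\<close> is visibly open; likewise \<open>B\<close>.\<close>
  have A: "A = (\<Union>U\<in>{U. U \<subseteq> I \<and> s < card U}. \<Inter>i\<in>U. {t. 0 < ?f t i})"
  proof (intro equalityI subsetI)
    fix t assume "t \<in> A"
    then show "t \<in> (\<Union>U\<in>{U. U \<subseteq> I \<and> s < card U}. \<Inter>i\<in>U. {t. 0 < ?f t i})"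
      by (intro UN_I[of "?P t"]) (auto simp: A_def)
  next
    fix t assume "t \<in> (\<Union>U\<in>{U. U \<subseteq> I \<and> s < card U}. \<Inter>i\<in>U. {t. 0 < ?f t i})"
    then obtain U where U: "U \<subseteq> I" "s < card U" "U \<subseteq> ?P t" by auto
    then have "card U \<le> card (?P t)" using I by (intro card_mono) auto
    then show "t \<in> A" using U by (simp add: A_def)
  qed
  have B: "B = (\<Union>U\<in>{U. U \<subseteq> I \<and> card I - Suc s < card U}. \<Inter>i\<in>U. {t. ?f t i < 0})"
  proof (intro equalityI subsetI)
    fix t assume "t \<in> B"
    then show "t \<in> (\<Union>U\<in>{U. U \<subseteq> I \<and> card I - Suc s < card U}. \<Inter>i\<in>U. {t. ?f t i < 0})"
      by (intro UN_I[of "?N t"]) (auto simp: B_def)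
  next
    fix t assume "t \<in> (\<Union>U\<in>{U. U \<subseteq> I \<and> card I - Suc s < card U}. \<Inter>i\<in>U. {t. ?f t i < 0})"
    then obtain U where U: "U \<subseteq> I" "card I - Suc s < card U" "U \<subseteq> ?N t" by auto
    then have "card U \<le> card (?N t)" using I by (intro card_mono) auto
    then show "t \<in> B" using U by (simp add: B_def)
  qed
  have "open A" unfolding A
    by (intro open_UN ballI open_INT open_Collect_less continuous_intros)
      (use I finite_subset in auto)
  moreover have "open B" unfolding B
    by (intro open_UN ballI open_INT open_Collect_less continuous_intros)
      (use I finite_subset in auto)
  moreover have "A \<inter> B = {}"
  proof -
    have "False" if "t \<in> A" "t \<in> B" for t
      using that total[of t] s by (auto simp: A_def B_def)
    then show ?thesis by blast
  qed
  moreover have "connected {0..1::real}" by simp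
  moreover have "0 \<notin> A" "1 \<in> A" using x y by (auto simp: A_def)
  ultimately have "\<not> {0..1} \<subseteq> A \<union> B"
    using connectedD[of "{0..1::real}" A B] by fastforce
  then obtain t where t: "t \<in> {0..1}" "t \<notin> A" "t \<notin> B" by blast
  then have "card (?P t) \<le> s" "card (?N t) \<le> card I - Suc s"
    by (auto simp: A_def B_def)
  then have "card (?Z t) = 1 \<and> card (?P t) = s"
    using total[of t] one[of t] s by linarith
  then show ?thesis using t(1) by blast
qed

lemma common_small_factor:
  fixes x m :: "'a \<Rightarrow> real"
  assumes "finite I" "\<forall>i\<in>I. x i \<noteq> 0"
  shows "\<exists>\<epsilon>>0. \<forall>i\<in>I. \<epsilon> * \<bar>m i\<bar> < \<bar>x i\<bar>"
  using assms
proof (induction I rule: finite_induct)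
  case empty
  then show ?case by (auto intro: exI[of _ 1])
next
  case (insert j I)
  then obtain \<epsilon> where \<epsilon>: "\<epsilon> > 0" "\<forall>i\<in>I. \<epsilon> * \<bar>m i\<bar> < \<bar>x i\<bar>" by auto
  \<comment> \<open>The \<open>1 +\<close> keeps the denominator positive when
    \<open>m j = 0\<close> and makes the resulting inequality strict.\<close>
  define \<delta> where "\<delta> = min \<epsilon> (\<bar>x j\<bar> / (1 + \<bar>m j\<bar>))"
  have pos: "\<delta> > 0" using \<epsilon> insert.prems by (simp add: \<delta>_def add_pos_nonneg)
  have "\<delta> * (1 + \<bar>m j\<bar>) \<le> \<bar>x j\<bar>"
    using \<epsilon> by (simp add: \<delta>_def pos_le_divide_eq[symmetric] add_pos_nonneg)
  then have "\<delta> * \<bar>m j\<bar> < \<bar>x j\<bar>" using pos by (simp add: distrib_left)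
  moreover have "\<delta> * \<bar>m i\<bar> < \<bar>x i\<bar>" if "i \<in> I" for i
  proof -
    have "\<delta> * \<bar>m i\<bar> \<le> \<epsilon> * \<bar>m i\<bar>" by (intro mult_right_mono) (auto simp: \<delta>_def)
    then show ?thesis using \<epsilon> that by fastforce
  qed
  ultimately show ?case using pos by blast
qed

section \<open>Subspaces in which any \<open>d - 1\<close> coordinates determine a vector\<close>

text \<open>Dimension \<open>d - 1\<close> and genericity are encoded together: restriction to any
  \<open>d - 1\<close> of the coordinates below \<open>2 * d\<close> is onto
  (\<open>interpolate\<close>) and has trivial kernel there (\<open>vanish\<close>).\<close>

locale generic_subspace =
  fixes d :: nat and D :: "(nat \<Rightarrow> real) set"
  assumes d_ge: "3 \<le> d"
    and lincomb: "\<And>x y a b. x \<in> D \<Longrightarrow> y \<in> D \<Longrightarrow> (\<lambda>i. a * x i + b * y i) \<in> D"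
    and interpolate: "\<And>Z v. Z \<subseteq> {..<2 * d} \<Longrightarrow> card Z = d - 1 \<Longrightarrow> \<exists>x\<in>D. \<forall>i\<in>Z. x i = v i"
    and vanish: "\<And>x Z i. x \<in> D \<Longrightarrow> Z \<subseteq> {..<2 * d} \<Longrightarrow> card Z = d - 1 \<Longrightarrow>
      \<forall>i\<in>Z. x i = 0 \<Longrightarrow> i < 2 * d \<Longrightarrow> x i = 0"
begin

lemma minus_sum_in:
  assumes "finite I" "x \<in> D" "\<And>i. i \<in> I \<Longrightarrow> m i \<in> D"
  shows "(\<lambda>k. x k - (\<Sum>i\<in>I. f i * m i k)) \<in> D"
  using assms(1,3)
proof (induction I rule: finite_induct)
  case empty
  then show ?case using assms(2) by simp
next
  case (insert j I)
  then have "(\<lambda>k. x k - (\<Sum>i\<in>I. f i * m i k)) \<in> D" "m j \<in> D" by auto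
  from lincomb[OF this, of 1 "- f j"] show ?case
    using insert.hyps by (simp add: algebra_simps)
qed

lemma zeros_eq:
  assumes "x \<in> D" "Z \<subseteq> {..<2 * d}" "card Z = d - 2" "\<forall>i\<in>Z. x i = 0" "k < 2 * d" "x k \<noteq> 0"
    and "i < 2 * d" "x i = 0"
  shows "i \<in> Z"
proof (rule ccontr)
  assume "i \<notin> Z"
  have "finite Z" using assms(2) finite_subset by blast
  then have "card (insert i Z) = d - 1" using \<open>i \<notin> Z\<close> assms(3) d_ge by simp
  then have "x k = 0" using vanish[OF assms(1), of "insert i Z" k] assms by auto
  then show False using assms by simp
qed

text \<open>The coordinates in \<open>insert a Z\<close> form a coordinate system, so
  \<open>y b\<close> is linear in them. If the coefficient at \<open>i\<close> were zero, the dual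
  basis vector \<open>m i\<close> would vanish on \<open>a\<close>, \<open>b\<close> and
  \<open>Z - {i}\<close>, hence also at \<open>i\<close>. The coefficient is the slope of coordinate
  \<open>b\<close> along the edge that leaves the vertex \<open>Z\<close> by releasing
  \<open>i\<close>.\<close>

lemma coordinate_expansion:
  assumes Z: "Z \<subseteq> {..<2 * d}" "card Z = d - 2"
    and ab: "a < 2 * d" "b < 2 * d" "a \<notin> Z" "b \<notin> Z" "a \<noteq> b"
  shows "\<exists>c. (\<forall>i\<in>Z. c i \<noteq> 0) \<and> (\<forall>y\<in>D. y a = 0 \<longrightarrow> y b = (\<Sum>i\<in>Z. c i * y i))"
proof -
  have fin: "finite Z" using Z finite_subset by blast
  have ins: "insert a Z \<subseteq> {..<2 * d}" "card (insert a Z) = d - 1"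
    using Z ab fin d_ge by auto
  have "\<exists>m\<in>D. \<forall>k\<in>insert a Z. m k = (if k = i then 1 else 0)" for i
    using interpolate[OF ins, of "\<lambda>k. if k = i then 1 else 0"] by simp
  then obtain m where mD: "\<And>i. m i \<in> D"
    and m: "\<And>i k. k \<in> insert a Z \<Longrightarrow> m i k = (if k = i then 1 else 0)"
    by metis
  have "m i b \<noteq> 0" if i: "i \<in> Z" for i
  proof
    assume b0: "m i b = 0"
    let ?Z = "insert a (insert b (Z - {i}))"
    have "card (Z - {i}) = d - 3" using fin i Z by simp
    then have "card ?Z = d - 1" using fin ab d_ge by (simp add: card_insert_if)
    moreover have "\<forall>k\<in>?Z. m i k = 0" using b0 m ab i by auto
    ultimately have "m i i = 0" using vanish[OF mD[of i], of ?Z i] ab Z i by auto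
    then show False using m[of i i] i by simp
  qed
  moreover have "y b = (\<Sum>i\<in>Z. m i b * y i)" if y: "y \<in> D" "y a = 0" for y
  proof -
    let ?z = "\<lambda>k. y k - (\<Sum>i\<in>Z. y i * m i k)"
    have zD: "?z \<in> D" by (rule minus_sum_in) (use fin y mD in auto)
    have "?z k = 0" if k: "k \<in> insert a Z" for k
    proof -
      have "(\<Sum>i\<in>Z. y i * m i k) = (\<Sum>i\<in>Z. if i = k then y i else 0)"
        by (rule sum.cong) (use m[OF k] in auto)
      also have "\<dots> = y k" using k fin y ab by auto
      finally show ?thesis by simp
    qed
    then have "?z b = 0" using vanish[OF zD ins] ab by blast
    then show ?thesis by (simp add: mult.commute)
  qed
  ultimately show ?thesis by (intro exI[of _ "\<lambda>i. m i b"] conjI ballI impI)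
qed

section \<open>Cells, their rays, and an upper bound for the rays of one cell\<close>

definition cells :: "nat set set" where
  "cells = {S. S \<subseteq> {..<2 * d} \<and> card S = d \<and>
     (\<exists>x\<in>D. (\<forall>i\<in>S. 0 < x i) \<and> (\<forall>i\<in>{..<2 * d} - S. x i < 0))}"

text \<open>A ray is named by its zero set; membership says that it lies in the closure of the sign
  region of \<open>S\<close>.\<close>

definition rays :: "nat set \<Rightarrow> nat set set" where
  "rays S = {Z. Z \<subseteq> {..<2 * d} \<and> card Z = d - 2 \<and>
     (\<exists>x\<in>D. (\<forall>i\<in>Z. x i = 0) \<and> (\<forall>i\<in>S - Z. 0 < x i) \<and> (\<forall>i\<in>{..<2 * d} - S - Z. x i < 0))}"

text \<open>These are the codes for rays: of two disjoint subsets of a set of \<open>d - 2\<close>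
  zeros, one has at most \<open>(d - 2) div 2\<close> elements.\<close>

definition small_sets :: "nat set set" where
  "small_sets = {N. N \<subseteq> {..<2 * d} \<and> card N \<le> (d - 2) div 2}"

lemma finite_cells: "finite cells"
  unfolding cells_def by simp

lemma finite_rays: "finite (rays S)"
  unfolding rays_def by simp

lemma finite_small_sets: "finite small_sets"
  unfolding small_sets_def by simp

text \<open>The halving trick behind the asymptotic upper bound theorem: on the section \<open>x a = \<plusminus>1\<close> of the
  closed cell, the coordinate \<open>x b\<close> is a linear objective, and \<open>F \<tau> Z\<close> collects the edges at the
  vertex \<open>Z\<close> along which \<open>\<tau> * x b\<close> decreases. Hence the vertex is the minimum of \<open>\<tau> * x b\<close> on the face
  obtained by putting the coordinates in \<open>F \<tau> Z\<close> to zero, and that face determines it.\<close>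

lemma card_rays_avoiding:
  assumes S: "S \<subseteq> {..<2 * d}" and ab: "a < 2 * d" "b < 2 * d" "a \<noteq> b"
  shows "card {Z \<in> rays S. a \<notin> Z \<and> b \<notin> Z} \<le> 2 * card small_sets"
proof -
  \<comment> \<open>With these signs the closed cell is given by the inequalities
    \<open>0 \<le> \<sigma> i * x i\<close>.\<close>
  define \<sigma> where "\<sigma> i = (if i \<in> S then 1 else - 1 :: real)" for i
  have \<sigma>2: "\<sigma> i * \<sigma> i = 1" for i by (simp add: \<sigma>_def)
  define V where "V = {Z \<in> rays S. a \<notin> Z \<and> b \<notin> Z}"
  have Vprops: "Z \<subseteq> {..<2 * d}" "card Z = d - 2" "a \<notin> Z" "b \<notin> Z" "finite Z" if "Z \<in> V" for Z
    using that finite_subset[of Z "{..<2 * d}"] unfolding rays_def V_def by auto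
  have "\<exists>x\<in>D. (\<forall>i\<in>Z. x i = 0) \<and> (\<forall>i<2 * d. 0 \<le> \<sigma> i * x i) \<and> x a = \<sigma> a" if Z: "Z \<in> V" for Z
  proof -
    obtain x where x: "x \<in> D" "\<forall>i\<in>Z. x i = 0" "\<forall>i\<in>S - Z. 0 < x i"
      "\<forall>i\<in>{..<2 * d} - S - Z. x i < 0"
      using Z unfolding rays_def V_def by blast
    have sx: "0 < \<sigma> i * x i" if "i < 2 * d" "i \<notin> Z" for i
      using that x by (auto simp: \<sigma>_def)
    have pos: "0 < \<sigma> a * x a" using sx ab Vprops(3)[OF Z] by blast
    let ?y = "\<lambda>i. (1 / (\<sigma> a * x a)) * x i + 0 * x i"
    have "?y \<in> D" by (rule lincomb[OF x(1) x(1)])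
    moreover have "\<forall>i\<in>Z. ?y i = 0" using x by simp
    moreover have "0 \<le> \<sigma> i * ?y i" if "i < 2 * d" for i
    proof -
      have "0 \<le> \<sigma> i * x i" using sx[OF that] x(2) by (cases "i \<in> Z") auto
      then have "0 \<le> (\<sigma> i * x i) / (\<sigma> a * x a)" using pos by simp
      then show ?thesis by simp
    qed
    moreover have "?y a = \<sigma> a" using pos by (auto simp: \<sigma>_def)
    ultimately show ?thesis by (intro bexI[of _ ?y] conjI allI impI)
  qed
  then obtain x where xD: "\<And>Z. Z \<in> V \<Longrightarrow> x Z \<in> D"
    and x0: "\<And>Z i. Z \<in> V \<Longrightarrow> i \<in> Z \<Longrightarrow> x Z i = 0"
    and xs: "\<And>Z i. Z \<in> V \<Longrightarrow> i < 2 * d \<Longrightarrow> 0 \<le> \<sigma> i * x Z i"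
    and xa: "\<And>Z. Z \<in> V \<Longrightarrow> x Z a = \<sigma> a"
    by metis
  have "\<exists>c. (\<forall>i\<in>Z. c i \<noteq> 0) \<and> (\<forall>y\<in>D. y a = 0 \<longrightarrow> y b = (\<Sum>i\<in>Z. c i * y i))" if "Z \<in> V" for Z
    using coordinate_expansion Vprops[OF that] ab by blast
  then obtain c where c0: "\<And>Z i. Z \<in> V \<Longrightarrow> i \<in> Z \<Longrightarrow> c Z i \<noteq> 0"
    and c: "\<And>Z y. Z \<in> V \<Longrightarrow> y \<in> D \<Longrightarrow> y a = 0 \<Longrightarrow> y b = (\<Sum>i\<in>Z. c Z i * y i)"
    by metis
  define F where "F \<tau> Z = {i \<in> Z. \<tau> * c Z i * \<sigma> i < 0}" for \<tau> Z
  \<comment> \<open>Both vectors have the same coordinate \<open>a\<close>, so the expansion applies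
    to their difference, and \<open>x Z\<close> contributes nothing on \<open>Z\<close>.\<close>
  have diff: "x Z' b - x Z b = (\<Sum>i\<in>Z. c Z i * x Z' i)" if "Z \<in> V" "Z' \<in> V" for Z Z'
  proof -
    have "(\<lambda>i. 1 * x Z' i + (- 1) * x Z i) \<in> D" using lincomb xD that by blast
    from c[OF that(1) this] show ?thesis using xa that x0 by simp
  qed
  \<comment> \<open>Indices in the common set \<open>F \<tau> Z\<close> belong to \<open>Z'\<close>,
    where \<open>x Z'\<close> vanishes; for all others the slope and the coordinate have compatible
    signs.\<close>
  have summand: "0 \<le> \<tau> * (c Z i * x Z' i)"
    if "Z \<in> V" "Z' \<in> V" "F \<tau> Z = F \<tau> Z'" "i \<in> Z" for \<tau> Z Z' i
  proof (cases "i \<in> F \<tau> Z")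
    case True
    then have "i \<in> Z'" using that F_def by auto
    then show ?thesis using x0 that by simp
  next
    case False
    then have "0 \<le> \<tau> * c Z i * \<sigma> i" using that by (auto simp: F_def)
    moreover have "0 \<le> \<sigma> i * x Z' i" using xs[OF that(2)] Vprops(1)[OF that(1)] that(4) by blast
    ultimately have "0 \<le> (\<tau> * c Z i * \<sigma> i) * (\<sigma> i * x Z' i)" by simp
    also have "\<dots> = \<tau> * (c Z i * x Z' i) * (\<sigma> i * \<sigma> i)" by (simp add: algebra_simps)
    finally show ?thesis by (simp add: \<sigma>2)
  qed
  \<comment> \<open>Exchanging \<open>Z\<close> and \<open>Z'\<close> shows that both have the same
    objective value. A vanishing sum of nonnegative terms with nonzero coefficients forces
    \<open>x Z'\<close> to be zero on \<open>Z\<close>, and then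
    \<open>Z \<subseteq> Z'\<close>.\<close>
  have inj: "inj_on (F \<tau>) V" if \<tau>: "\<tau> \<noteq> 0" for \<tau>
  proof (rule inj_onI)
    fix Z Z' assume Z: "Z \<in> V" "Z' \<in> V" and eq: "F \<tau> Z = F \<tau> Z'"
    have le: "0 \<le> \<tau> * (x Z' b - x Z b)" if "Z \<in> V" "Z' \<in> V" "F \<tau> Z = F \<tau> Z'" for Z Z'
      unfolding diff[OF that(1,2)] sum_distrib_left by (rule sum_nonneg) (use summand that in auto)
    have "\<tau> * (x Z' b - x Z b) = 0"
      using le[OF Z eq] le[OF Z(2,1) eq[symmetric]] by (simp add: algebra_simps)
    then have "(\<Sum>i\<in>Z. \<tau> * (c Z i * x Z' i)) = 0"
      unfolding diff[OF Z] sum_distrib_left .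
    then have "\<forall>i\<in>Z. \<tau> * (c Z i * x Z' i) = 0"
      using sum_nonneg_eq_0_iff[OF Vprops(5)[OF Z(1)]] summand[OF Z eq] by (metis (no_types, lifting))
    then have "\<forall>i\<in>Z. x Z' i = 0" using \<tau> c0[OF Z(1)] by auto
    moreover have "x Z' a \<noteq> 0" using xa[OF Z(2)] by (simp add: \<sigma>_def)
    ultimately have "Z \<subseteq> Z'"
      using zeros_eq[OF xD[OF Z(2)] Vprops(1,2)[OF Z(2)] _ ab(1)] x0[OF Z(2)] Vprops(1)[OF Z(1)] by blast
    then show "Z = Z'" using Vprops(2,5)[OF Z(2)] Vprops(2)[OF Z(1)] card_subset_eq by metis
  qed
  let ?W = "\<lambda>\<tau>. {Z \<in> V. card (F \<tau> Z) \<le> (d - 2) div 2}"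
  have W: "card (?W \<tau>) \<le> card small_sets" if "\<tau> \<noteq> 0" for \<tau>
  proof (rule card_inj_on_le)
    show "inj_on (F \<tau>) (?W \<tau>)" by (rule inj_on_subset[OF inj[OF that]]) auto
    show "F \<tau> ` ?W \<tau> \<subseteq> small_sets"
      using Vprops(1) unfolding small_sets_def F_def by blast
  qed (rule finite_small_sets)
  have "V \<subseteq> ?W 1 \<union> ?W (- 1)"
  proof
    fix Z assume Z: "Z \<in> V"
    have "F 1 Z \<inter> F (- 1) Z = {}" by (auto simp: F_def)
    moreover have "F 1 Z \<union> F (- 1) Z \<subseteq> Z" by (auto simp: F_def)
    ultimately have "card (F 1 Z) + card (F (- 1) Z) \<le> d - 2"
      using Vprops(2,5)[OF Z] by (metis card_Un_disjoint card_mono finite_Un finite_subset)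
    then have "card (F 1 Z) \<le> (d - 2) div 2 \<or> card (F (- 1) Z) \<le> (d - 2) div 2" by linarith
    then show "Z \<in> ?W 1 \<union> ?W (- 1)" using Z by blast
  qed
  then have "card V \<le> card (?W 1 \<union> ?W (- 1))"
    by (rule card_mono[rotated]) (simp add: finite_rays V_def)
  also have "\<dots> \<le> card (?W 1) + card (?W (- 1))" by (rule card_Un_le)
  also have "\<dots> \<le> 2 * card small_sets" using W[of 1] W[of "- 1"] by simp
  finally show ?thesis unfolding V_def .
qed

text \<open>Each ray has \<open>d + 2\<close> nonzero coordinates, so it avoids some ordered pair
  \<open>(a, b)\<close>. There are at most \<open>4 * d ^ 2\<close> pairs, each accounting for at
  most \<open>2 * card small_sets\<close> rays.\<close>

lemma card_rays_le:
  assumes S: "S \<subseteq> {..<2 * d}"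
  shows "card (rays S) \<le> 8 * d ^ 2 * card small_sets"
proof -
  let ?V = "\<lambda>a b. {Z \<in> rays S. a \<notin> Z \<and> b \<notin> Z}"
  let ?I = "Sigma {..<2 * d} (\<lambda>a. {..<2 * d} - {a})"
  have finI: "finite ?I" by simp
  have "rays S \<subseteq> (\<Union>(a, b)\<in>?I. ?V a b)"
  proof
    fix Z assume Z: "Z \<in> rays S"
    then have Z': "Z \<subseteq> {..<2 * d}" "card Z = d - 2" by (auto simp: rays_def)
    have "card ({..<2 * d} - Z) = d + 2"
      using Z' d_ge by (subst card_Diff_subset) (auto intro: finite_subset)
    then have "2 \<le> card ({..<2 * d} - Z)" by simp
    then obtain B where B: "B \<subseteq> {..<2 * d} - Z" "card B = 2"
      by (meson obtain_subset_with_card_n)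
    obtain a b where "B = {a, b}" "a \<noteq> b" using B(2) by (meson card_2_iff)
    then show "Z \<in> (\<Union>(a, b)\<in>?I. ?V a b)" using B Z by auto
  qed
  then have "card (rays S) \<le> card (\<Union>(a, b)\<in>?I. ?V a b)"
    by (rule card_mono[rotated]) (use finI finite_rays in auto)
  also have "\<dots> \<le> (\<Sum>(a, b)\<in>?I. card (?V a b))"
    using card_UN_le[OF finI, of "\<lambda>(a, b). ?V a b"] by (simp add: case_prod_beta)
  also have "\<dots> \<le> (\<Sum>(a, b)\<in>?I. 2 * card small_sets)"
    by (rule sum_mono) (use card_rays_avoiding[OF S] in auto)
  also have "\<dots> = card ?I * (2 * card small_sets)" by (simp add: case_prod_beta)
  also have "\<dots> \<le> card ({..<2 * d} \<times> {..<2 * d}) * (2 * card small_sets)"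
    by (intro mult_right_mono card_mono) auto
  also have "\<dots> = 8 * d ^ 2 * card small_sets" by (simp add: power2_eq_square)
  finally show ?thesis .
qed

section \<open>Balanced rays: how many there are and how many cells surround each\<close>

text \<open>Rounding down means that for odd \<open>d\<close> there is one more negative entry than
  positive ones.\<close>

definition balanced_rays :: "nat set set" where
  "balanced_rays = {Z. Z \<subseteq> {..<2 * d} \<and> card Z = d - 2 \<and>
     (\<exists>x\<in>D. (\<forall>i<2 * d. x i = 0 \<longleftrightarrow> i \<in> Z) \<and> card {i \<in> {..<2 * d}. 0 < x i} = (d + 2) div 2)}"

lemma finite_balanced_rays: "finite balanced_rays"
  unfolding balanced_rays_def by simp

text \<open>The vectors of \<open>D\<close> vanishing on \<open>Y\<close> form a plane. Each nonzero
  one has at most one further zero, so a path in the plane that avoids the origin changes one sign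
  at a time and must pass a balanced ray.\<close>

lemma balanced_ray_extending:
  assumes Y: "Y \<subseteq> {..<2 * d}" "card Y = d - 3"
  shows "\<exists>Z\<in>balanced_rays. Y \<subseteq> Z"
proof -
  let ?n = "{..<2 * d}" and ?I = "{..<2 * d} - Y"
  have finY: "finite Y" using Y finite_subset by blast
  have cardI: "card ?I = d + 3" using Y finY d_ge by (subst card_Diff_subset) auto
  have finI: "finite ?I" by simp
  have "?I \<noteq> {}" using cardI by (metis add_eq_0_iff_both_eq_0 card.empty zero_neq_numeral)
  then obtain j where j: "j \<in> ?I" by blast
  have "card (?I - {j}) = d + 2" using cardI j by simp
  then have "?I - {j} \<noteq> {}" by (metis add_eq_0_iff_both_eq_0 card.empty zero_neq_numeral)
  then obtain l where l: "l \<in> ?I" "l \<noteq> j" by blast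
  have ins: "insert j (insert l Y) \<subseteq> ?n" "card (insert j (insert l Y)) = d - 1"
    using j l Y finY d_ge by auto
  obtain w where wD: "w \<in> D" and "\<forall>i\<in>insert j (insert l Y). w i = (if i = l then 1 else 0)"
    using interpolate[OF ins, of "\<lambda>i. if i = l then 1 else 0"] by blast
  with j l have w: "\<forall>i\<in>Y. w i = 0" "w j = 0" "w l = 1" by auto
  obtain u where uD: "u \<in> D" and "\<forall>i\<in>insert j (insert l Y). u i = (if i = j then 1 else 0)"
    using interpolate[OF ins, of "\<lambda>i. if i = j then 1 else 0"] by blast
  with j l have u: "\<forall>i\<in>Y. u i = 0" "u j = 1" by auto
  have one: "card {i \<in> ?I. x i = 0} \<le> 1"
    if x: "x \<in> D" "\<forall>i\<in>Y. x i = 0" and k: "k \<in> ?I" "x k \<noteq> 0" for x k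
  proof (rule ccontr)
    assume "\<not> ?thesis"
    then have "2 \<le> card {i \<in> ?I. x i = 0}" by simp
    then obtain B where B: "B \<subseteq> {i \<in> ?I. x i = 0}" "card B = 2"
      by (meson obtain_subset_with_card_n)
    have "card (B \<union> Y) = card B + card Y"
      using B finY finite_subset[OF B(1)] by (intro card_Un_disjoint) auto
    then have "card (B \<union> Y) = d - 1" using B(2) Y d_ge by simp
    moreover have "B \<union> Y \<subseteq> ?n" "\<forall>i\<in>B \<union> Y. x i = 0" using B Y x by auto
    ultimately have "x k = 0" using vanish[OF x(1)] k by blast
    then show False using k by simp
  qed
  have result: ?thesis
    if x: "x \<in> D" "\<forall>i\<in>Y. x i = 0" and z: "card {i \<in> ?I. x i = 0} = 1"
      and p: "card {i \<in> ?I. 0 < x i} = (d + 2) div 2" for x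
  proof -
    let ?Z = "Y \<union> {i \<in> ?I. x i = 0}"
    have "card ?Z = card Y + card {i \<in> ?I. x i = 0}"
      using finY by (intro card_Un_disjoint) auto
    then have "card ?Z = d - 2" using Y z d_ge by simp
    moreover have "?Z \<subseteq> ?n" using Y by auto
    moreover have "\<forall>i<2 * d. x i = 0 \<longleftrightarrow> i \<in> ?Z" using x Y by auto
    moreover have "{i \<in> ?n. 0 < x i} = {i \<in> ?I. 0 < x i}" using x(2) by force
    ultimately have "?Z \<in> balanced_rays"
      using p unfolding balanced_rays_def by (intro CollectI conjI bexI[OF _ x(1)]) simp_all
    then show ?thesis by blast
  qed
  \<comment> \<open>The assumption \<open>nz\<close> says that the segment misses the zero vector,
    which guarantees at most one zero at every \<open>t\<close>.\<close>
  have through: ?thesis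
    if x: "x \<in> D" "\<forall>i\<in>Y. x i = 0" and y: "y \<in> D" "\<forall>i\<in>Y. y i = 0"
      and nz: "\<And>t. \<exists>k\<in>?I. (1 - t) * x k + t * y k \<noteq> 0"
      and px: "card {i \<in> ?I. 0 < x i} \<le> (d + 2) div 2"
      and py: "(d + 2) div 2 < card {i \<in> ?I. 0 < y i}" for x y
  proof -
    have D: "(\<lambda>i. (1 - t) * x i + t * y i) \<in> D" for t by (rule lincomb[OF x(1) y(1)])
    have Y0: "\<forall>i\<in>Y. (1 - t) * x i + t * y i = 0" for t using x y by simp
    have "card {i \<in> ?I. (1 - t) * x i + t * y i = 0} \<le> 1" for t
      using one[OF D Y0] nz[of t] by blast
    moreover have "(d + 2) div 2 < card ?I" using cardI by simp
    ultimately obtain t where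
      "card {i \<in> ?I. (1 - t) * x i + t * y i = 0} = 1"
      "card {i \<in> ?I. 0 < (1 - t) * x i + t * y i} = (d + 2) div 2"
      using segment_meets_balanced[OF finI _ _ px py] by blast
    then show ?thesis by (rule result[OF D Y0])
  qed
  text \<open>Walk from \<open>w\<close>, which has more positive than negative entries, through \<open>u\<close> to \<open>- w\<close>.\<close>
  have walk: ?thesis
    if w: "w \<in> D" "\<forall>i\<in>Y. w i = 0" "w j = 0" "w l \<noteq> 0"
      and le: "card {i \<in> ?I. w i < 0} \<le> card {i \<in> ?I. 0 < w i}" for w
  proof -
    let ?w = "\<lambda>i. (- 1) * w i + 0 * w i"
    have w': "?w \<in> D" by (rule lincomb[OF w(1) w(1)])
    have w'Y: "\<forall>i\<in>Y. ?w i = 0" using w by simp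
    have pos': "{i \<in> ?I. 0 < ?w i} = {i \<in> ?I. w i < 0}" by auto
    have "card {i \<in> ?I. w i = 0} \<le> 1" using one[OF w(1,2) l(1) w(4)] .
    moreover have "card {i \<in> ?I. w i = 0} \<noteq> 0" using j w(3) by auto
    ultimately have z: "card {i \<in> ?I. w i = 0} = 1" by linarith
    have "card ?I = card (({i \<in> ?I. 0 < w i} \<union> {i \<in> ?I. w i < 0}) \<union> {i \<in> ?I. w i = 0})"
      by (rule arg_cong[of _ _ card]) auto
    also have "\<dots> = card ({i \<in> ?I. 0 < w i} \<union> {i \<in> ?I. w i < 0}) + card {i \<in> ?I. w i = 0}"
      by (intro card_Un_disjoint) auto
    also have "card ({i \<in> ?I. 0 < w i} \<union> {i \<in> ?I. w i < 0})
        = card {i \<in> ?I. 0 < w i} + card {i \<in> ?I. w i < 0}"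
      by (intro card_Un_disjoint) auto
    finally have total: "card {i \<in> ?I. 0 < w i} + card {i \<in> ?I. w i < 0} = d + 2"
      using z cardI by simp
    show ?thesis
    proof (cases "card {i \<in> ?I. w i < 0} = (d + 2) div 2")
      case True
      then show ?thesis using result[OF w' w'Y] z pos' by simp
    next
      case False
      then have pw: "(d + 2) div 2 < card {i \<in> ?I. 0 < w i}"
        and pw': "card {i \<in> ?I. 0 < ?w i} \<le> (d + 2) div 2"
        using total le unfolding pos' by linarith+
      show ?thesis
      \<comment> \<open>The side of the threshold on which \<open>u\<close> lies decides which half
        of the walk crosses it. Coordinate \<open>j\<close> vanishes only at the endpoint
        \<open>?w\<close> or \<open>w\<close> of that half, where coordinate \<open>l\<close> is
        nonzero, so the segment avoids the origin.\<close>
      proof (cases "(d + 2) div 2 < card {i \<in> ?I. 0 < u i}")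
        case True
        show ?thesis
        proof (rule through[OF w' w'Y uD u(1) _ pw' True])
          show "\<exists>k\<in>?I. (1 - t) * ?w k + t * u k \<noteq> 0" for t
          proof (cases "t = 0")
            case True then show ?thesis using w(4) l by (intro bexI[of _ l]) auto
          next
            case False then show ?thesis using w(3) u(2) j by (intro bexI[of _ j]) auto
          qed
        qed
      next
        case False
        then have pu: "card {i \<in> ?I. 0 < u i} \<le> (d + 2) div 2" by simp
        show ?thesis
        proof (rule through[OF uD u(1) w(1,2) _ pu pw])
          show "\<exists>k\<in>?I. (1 - t) * u k + t * w k \<noteq> 0" for t
          proof (cases "t = 1")
            case True then show ?thesis using w(4) l by (intro bexI[of _ l]) auto
          next
            case False then show ?thesis using w(3) u(2) j by (intro bexI[of _ j]) auto
          qed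
        qed
      qed
    qed
  qed
  show ?thesis
  proof (cases "card {i \<in> ?I. w i < 0} \<le> card {i \<in> ?I. 0 < w i}")
    case True
    then show ?thesis using walk[OF wD w(1,2)] w(3) by simp
  next
    case False
    have "(\<lambda>i. (- 1) * w i + 0 * w i) \<in> D" by (rule lincomb[OF wD wD])
    from walk[OF this] show ?thesis using w False by simp
  qed
qed

text \<open>Every \<open>(d - 3)\<close>-set extends to a balanced ray, and a ray contains only
  \<open>d - 2\<close> such sets.\<close>

lemma card_balanced_rays: "2 * d choose (d - 3) \<le> card balanced_rays * (d - 2)"
proof -
  let ?Y = "\<lambda>Z. {Y. Y \<subseteq> Z \<and> card Y = d - 3}"
  have Z: "finite Z" "card Z = d - 2" if "Z \<in> balanced_rays" for Z
    using that finite_subset[of Z "{..<2 * d}"] unfolding balanced_rays_def by auto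
  have "?Y {..<2 * d} \<subseteq> (\<Union>Z\<in>balanced_rays. ?Y Z)"
    using balanced_ray_extending by blast
  then have "card (?Y {..<2 * d}) \<le> card (\<Union>Z\<in>balanced_rays. ?Y Z)"
    by (rule card_mono[rotated]) (use finite_balanced_rays Z in auto)
  also have "\<dots> \<le> (\<Sum>Z\<in>balanced_rays. card (?Y Z))"
    by (rule card_UN_le[OF finite_balanced_rays])
  also have "\<dots> = (\<Sum>Z\<in>balanced_rays. d - 2)"
  proof (rule sum.cong)
    fix Z assume "Z \<in> balanced_rays"
    then have "card (?Y Z) = (d - 2) choose (d - 3)" using Z n_subsets[of Z "d - 3"] by simp
    also have "\<dots> = (d - 2) choose (d - 2 - (d - 3))"
      by (rule binomial_symmetric) simp
    also have "d - 2 - (d - 3) = 1" using d_ge by simp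
    finally show "card (?Y Z) = d - 2" by simp
  qed simp
  finally show ?thesis using n_subsets[of "{..<2 * d}" "d - 3"] by simp
qed

text \<open>Adding a small multiple of a vector with prescribed signs on \<open>Z\<close> keeps all
  signs off \<open>Z\<close>. The free choice is the set \<open>T\<close> of zeros made positive,
  whose size \<open>?k\<close> brings the positive entries up to \<open>d\<close>.\<close>

lemma cells_around_balanced_ray:
  assumes "Z \<in> balanced_rays"
  shows "(d - 2) choose ((d - 2) div 2) \<le> card {S \<in> cells. Z \<in> rays S}"
proof -
  from assms obtain x where Z: "Z \<subseteq> {..<2 * d}" "card Z = d - 2"
    and x: "x \<in> D" "\<forall>i<2 * d. x i = 0 \<longleftrightarrow> i \<in> Z"
    and p: "card {i \<in> {..<2 * d}. 0 < x i} = (d + 2) div 2"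
    unfolding balanced_rays_def by blast
  let ?n = "{..<2 * d}"
  let ?P = "{i \<in> ?n. 0 < x i}"
  let ?k = "d - (d + 2) div 2"
  let ?T = "{T. T \<subseteq> Z \<and> card T = ?k}"
  have finZ: "finite Z" using Z finite_subset by blast
  have disj: "?P \<inter> Z = {}" using x(2) by auto
  have cell: "?P \<union> T \<in> {S \<in> cells. Z \<in> rays S}" if T: "T \<in> ?T" for T
  proof -
    have TZ: "T \<subseteq> Z" "card T = ?k" using T by auto
    have finT: "finite T" using TZ finZ finite_subset by blast
    have "card (?P \<union> T) = card ?P + card T"
      using finT disj TZ by (intro card_Un_disjoint) auto
    then have cS: "card (?P \<union> T) = d" using p TZ d_ge by simp
    have "card (?n - Z) = d + 2" using Z finZ d_ge by (subst card_Diff_subset) auto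
    then have "?n - Z \<noteq> {}" by (metis add_eq_0_iff_both_eq_0 card.empty zero_neq_numeral)
    \<comment> \<open>Interpolation takes exactly \<open>d - 1\<close> coordinates while
      \<open>Z\<close> has \<open>d - 2\<close>; the value at the extra index \<open>j\<close> does
      not matter, since \<open>x j\<close> dominates there.\<close>
    then obtain j where j: "j \<in> ?n - Z" by blast
    have ins: "insert j Z \<subseteq> ?n" "card (insert j Z) = d - 1" using j Z finZ d_ge by auto
    obtain m where m: "m \<in> D" "\<forall>i\<in>insert j Z. m i = (if i \<in> T then 1 else - 1)"
      using interpolate[OF ins, of "\<lambda>i. if i \<in> T then 1 else - 1"] by auto
    obtain \<epsilon> where \<epsilon>: "\<epsilon> > 0" "\<forall>i\<in>?n - Z. \<epsilon> * \<bar>m i\<bar> < \<bar>x i\<bar>"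
      using common_small_factor[of "?n - Z" x m] x(2) by auto
    let ?y = "\<lambda>i. 1 * x i + \<epsilon> * m i"
    have yD: "?y \<in> D" by (rule lincomb[OF x(1) m(1)])
    have far: "\<bar>\<epsilon> * m i\<bar> < \<bar>x i\<bar>" if "i \<in> ?n - Z" for i
      using \<epsilon> that by (simp add: abs_mult)
    have "0 < ?y i" if i: "i \<in> ?P \<union> T" for i
    proof (cases "i \<in> Z")
      case True
      then have "i \<in> T" "x i = 0" using i disj x(2) Z by auto
      then show ?thesis using m True \<epsilon> by simp
    next
      case False
      then have "i \<in> ?n - Z" "0 < x i" using i TZ by auto
      then show ?thesis using far[of i] by simp
    qed
    moreover have "?y i < 0" if i: "i \<in> ?n - (?P \<union> T)" for i
    proof (cases "i \<in> Z")
      case True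
      then have "x i = 0" using i x(2) by auto
      then show ?thesis using m True \<epsilon> i by simp
    next
      case False
      then have "i \<in> ?n - Z" "x i < 0" using i x(2) by force+
      then show ?thesis using far[of i] by simp
    qed
    moreover have sub: "?P \<union> T \<subseteq> ?n" using TZ Z by auto
    ultimately have "?P \<union> T \<in> cells"
      unfolding cells_def using cS by (intro CollectI conjI bexI[OF _ yD] ballI)
    moreover have "Z \<in> rays (?P \<union> T)"
    proof -
      have "x i < 0" if "i \<in> ?n - (?P \<union> T) - Z" for i
        using that x(2) by force
      moreover have "0 < x i" if "i \<in> ?P \<union> T - Z" for i using that TZ by auto
      moreover have "\<forall>i\<in>Z. x i = 0" using x(2) Z by auto
      ultimately show ?thesis
        unfolding rays_def using Z by (intro CollectI conjI bexI[OF _ x(1)] ballI) blast+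
    qed
    ultimately show ?thesis by blast
  qed
  have "card ?T = (d - 2) choose ?k" using n_subsets[OF finZ, of ?k] Z by simp
  \<comment> \<open>For even \<open>d\<close> the two lower indices agree; for odd \<open>d\<close>
    they are complementary in \<open>d - 2\<close>.\<close>
  also have "\<dots> = (d - 2) choose ((d - 2) div 2)"
  proof (cases "even d")
    case True
    then have "?k = (d - 2) div 2" by (auto elim: evenE)
    then show ?thesis by simp
  next
    case False
    then obtain e where e: "d = 2 * e + 1" by (auto elim: oddE)
    have "(d - 2) choose ?k = (d - 2) choose (d - 2 - ?k)"
      by (rule binomial_symmetric) (use e d_ge in auto)
    also have "d - 2 - ?k = (d - 2) div 2" using e d_ge by simp
    finally show ?thesis .
  qed
  finally have "card ?T = (d - 2) choose ((d - 2) div 2)" .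
  moreover have "card ?T \<le> card {S \<in> cells. Z \<in> rays S}"
  proof (rule card_inj_on_le)
    show "inj_on (\<lambda>T. ?P \<union> T) ?T" using disj by (intro inj_onI) blast
    show "(\<lambda>T. ?P \<union> T) ` ?T \<subseteq> {S \<in> cells. Z \<in> rays S}" using cell by blast
  qed (simp add: finite_cells)
  ultimately show ?thesis by simp
qed

text \<open>Double counting of pairs of a cell and a balanced ray on its boundary; the last factor
  \<open>d - 2\<close> comes from \<open>card_balanced_rays\<close>.\<close>

lemma cells_lower_bound:
  "(2 * d choose (d - 3)) * ((d - 2) choose ((d - 2) div 2))
    \<le> card cells * (8 * d ^ 2 * card small_sets) * (d - 2)"
proof -
  let ?c = "(d - 2) choose ((d - 2) div 2)"
  have "card balanced_rays * ?c \<le> (\<Sum>Z\<in>balanced_rays. card {S \<in> cells. Z \<in> rays S})"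
    using sum_mono[OF cells_around_balanced_ray, of balanced_rays "\<lambda>Z. Z"] by simp
  also have "\<dots> = (\<Sum>S\<in>cells. card {Z \<in> balanced_rays. Z \<in> rays S})"
    by (rule sum_multicount_gen) (use finite_balanced_rays finite_cells in auto)
  also have "\<dots> \<le> (\<Sum>S\<in>cells. 8 * d ^ 2 * card small_sets)"
  proof (rule sum_mono)
    fix S assume "S \<in> cells"
    then have S: "S \<subseteq> {..<2 * d}" by (simp add: cells_def)
    have "card {Z \<in> balanced_rays. Z \<in> rays S} \<le> card (rays S)"
      by (rule card_mono[OF finite_rays]) auto
    then show "card {Z \<in> balanced_rays. Z \<in> rays S} \<le> 8 * d ^ 2 * card small_sets"
      using card_rays_le[OF S] by linarith
  qed
  finally have le: "card balanced_rays * ?c \<le> card cells * (8 * d ^ 2 * card small_sets)" by simp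
  have "(2 * d choose (d - 3)) * ?c \<le> card balanced_rays * (d - 2) * ?c"
    by (intro mult_right_mono card_balanced_rays) simp
  also have "\<dots> = card balanced_rays * ?c * (d - 2)" by simp
  also have "\<dots> \<le> card cells * (8 * d ^ 2 * card small_sets) * (d - 2)"
    by (intro mult_right_mono le) simp
  finally show ?thesis .
qed

end

section \<open>Affine dependencies of points in general position\<close>

lemma lookup_scaleR: "Poly_Mapping.lookup (r *\<^sub>R (x :: point)) i = r * Poly_Mapping.lookup x i"
  by (simp add: scaleR_poly_mapping_def)

lemma in_Rn_iff: "x \<in> Rn m \<longleftrightarrow> (\<forall>j\<ge>m. Poly_Mapping.lookup x j = 0)"
  unfolding Rn_def by (auto simp: in_keys_iff subset_iff) (meson not_less)

lemma sum_scaleR_in_Rn: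
  assumes "\<And>i. i \<in> I \<Longrightarrow> q i \<in> Rn m"
  shows "(\<Sum>i\<in>I. c i *\<^sub>R q i) \<in> Rn m"
  using assms by (auto simp: in_Rn_iff lookup_sum lookup_scaleR)

abbreviation unit_point :: "nat \<Rightarrow> point" where
  "unit_point j \<equiv> Poly_Mapping.single j 1"

lemma Rn_expansion:
  assumes "x \<in> Rn m"
  shows "x = (\<Sum>j<m. Poly_Mapping.lookup x j *\<^sub>R unit_point j)"
proof (rule poly_mapping_eqI)
  fix k
  have "Poly_Mapping.lookup (\<Sum>j<m. Poly_Mapping.lookup x j *\<^sub>R unit_point j) k
      = (\<Sum>j<m. if j = k then Poly_Mapping.lookup x j else 0)"
    unfolding lookup_sum lookup_scaleR lookup_single when_def by (rule sum.cong) auto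
  also have "\<dots> = Poly_Mapping.lookup x k" using assms by (auto simp: in_Rn_iff)
  finally show "Poly_Mapping.lookup x k
      = Poly_Mapping.lookup (\<Sum>j<m. Poly_Mapping.lookup x j *\<^sub>R unit_point j) k" by simp
qed

lemma linear_on_Rn:
  fixes g :: "point \<Rightarrow> real"
  assumes "linear g" "x \<in> Rn m"
  shows "g x = (\<Sum>j<m. Poly_Mapping.lookup x j * g (unit_point j))"
  by (subst Rn_expansion[OF assms(2)]) (simp add: linear_sum[OF assms(1)] linear_cmul[OF assms(1)])

lemma independent_unit_points: "independent (unit_point ` {..<m})"
proof
  assume "dependent (unit_point ` {..<m})"
  then obtain u v where v: "v \<in> unit_point ` {..<m}" "u v \<noteq> 0"
    and u: "(\<Sum>v\<in>unit_point ` {..<m}. u v *\<^sub>R v) = 0"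
    by (auto simp: dependent_finite)
  from v obtain j where j: "v = unit_point j" "j < m" by auto
  have "0 = Poly_Mapping.lookup (\<Sum>v\<in>unit_point ` {..<m}. u v *\<^sub>R v) j" using u by simp
  also have "\<dots> = (\<Sum>w\<in>unit_point ` {..<m}. if w = v then u w else 0)"
    unfolding lookup_sum lookup_scaleR
    by (rule sum.cong) (auto simp: j lookup_single when_def split: if_splits)
  also have "\<dots> = u v" using v by simp
  finally show False using v by simp
qed

lemma card_unit_points: "card (unit_point ` {..<m}) = m"
  by (subst card_image) (auto intro!: inj_onI dest: arg_cong[of _ _ "\<lambda>x. Poly_Mapping.lookup x _"]
      simp: lookup_single when_def split: if_splits)

section \<open>Homogenisation of points in general position\<close>

text \<open>Points of \<open>Rn d\<close> have coordinate \<open>d\<close> equal to zero; setting it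
  to one turns affine dependencies into linear ones.\<close>

definition lift :: "nat \<Rightarrow> point \<Rightarrow> point" where
  "lift d x = x + unit_point d"

lemma lift_in_Rn: "x \<in> Rn d \<Longrightarrow> lift d x \<in> Rn (Suc d)"
  by (auto simp: lift_def in_Rn_iff lookup_add lookup_single when_def)

lemma inj_lift: "inj (lift d)"
  by (auto simp: lift_def inj_def)

lemma sum_scaleR_lift:
  "(\<Sum>i\<in>I. c i *\<^sub>R lift d (p i)) = (\<Sum>i\<in>I. c i *\<^sub>R p i) + (\<Sum>i\<in>I. c i) *\<^sub>R unit_point d"
  by (simp add: lift_def scaleR_add_right sum.distrib scaleR_sum_left)

text \<open>A functional that vanishes on the lifts but not at some \<open>x\<close> of
  \<open>Rn (Suc d)\<close> would put all of \<open>W\<close> on one hyperplane, against general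
  position.\<close>

lemma span_lift_general_position:
  assumes gp: "general_position d P" and W: "W \<subseteq> P" "card W = d + 1"
  shows "Rn (Suc d) \<subseteq> span (lift d ` W)"
proof (rule ccontr)
  assume "\<not> ?thesis"
  then obtain x where x: "x \<in> Rn (Suc d)" "x \<notin> span (lift d ` W)" by blast
  obtain B where B: "B \<subseteq> lift d ` W" "independent B" "lift d ` W \<subseteq> span B"
    using maximal_independent_subset by blast
  have "span (lift d ` W) = span B"
    using B by (metis span_eq span_superset subset_trans)
  then have xB: "x \<notin> span B" using x by simp
  then have "independent (insert x B)" using B(2) by (simp add: independent_insert)
  then obtain g :: "point \<Rightarrow> real" where g: "linear g" "\<forall>v\<in>insert x B. g v = (if v = x then 1 else 0)"
    using linear_independent_extend[of "insert x B" "\<lambda>v. if v = x then 1 else 0"] by blast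
  have "x \<notin> B" using xB span_base by blast
  then have "\<forall>v\<in>B. g v = 0" using g(2) by auto
  then have g0: "g v = 0" if "v \<in> span B" for v
    using linear_eq_0_on_span[OF g(1)] that by blast
  have WR: "w \<in> Rn d" if "w \<in> W" for w using gp W that by (auto simp: general_position_def)
  let ?a = "\<lambda>j. g (unit_point j)"
  have eq: "(\<Sum>j<d. ?a j * Poly_Mapping.lookup w j) = - ?a d" if w: "w \<in> W" for w
  proof -
    have "g (lift d w) = 0" using g0 B(3) w by blast
    then have "g w + g (unit_point d) = 0" by (simp add: lift_def linear_add[OF g(1)])
    then show ?thesis
      using linear_on_Rn[OF g(1) WR[OF w]] by (simp add: mult.commute)
  qed
  \<comment> \<open>If the first \<open>d\<close> coefficients vanished, the equation at a point of
    \<open>W\<close> would kill the constant term too, and \<open>g x\<close> would be zero.\<close>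
  have "\<exists>j<d. ?a j \<noteq> 0"
  proof (rule ccontr)
    assume "\<not> ?thesis"
    then have a0: "?a j = 0" if "j < d" for j using that by blast
    have "W \<noteq> {}" using W by auto
    then obtain w where "w \<in> W" by blast
    from eq[OF this] have "?a d = 0" using a0 by simp
    then have "g x = 0" using linear_on_Rn[OF g(1) x(1)] a0 by (simp add: less_Suc_eq)
    then show False using g(2) by simp
  qed
  then have "hyperplane d {x \<in> Rn d. (\<Sum>j<d. ?a j * Poly_Mapping.lookup x j) = - ?a d}"
    unfolding hyperplane_def by (intro exI[of _ ?a] exI[of _ "- ?a d"] conjI refl)
  moreover have "W \<subseteq> {x \<in> Rn d. (\<Sum>j<d. ?a j * Poly_Mapping.lookup x j) = - ?a d}"
    using eq WR by blast
  ultimately show False using gp W unfolding general_position_def by blast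
qed

text \<open>If one of the \<open>d + 1\<close> lifts were redundant, at most \<open>d\<close>
  vectors would span the \<open>d + 1\<close> independent unit points.\<close>

lemma independent_lift_general_position:
  assumes gp: "general_position d P" and W: "W \<subseteq> P" "card W = d + 1"
  shows "independent (lift d ` W)"
proof
  assume "dependent (lift d ` W)"
  then obtain a where a: "a \<in> lift d ` W" "a \<in> span (lift d ` W - {a})"
    by (auto simp: dependent_def)
  have finW: "finite W" using W(2) card.infinite by fastforce
  have "span (insert a (lift d ` W - {a})) = span (lift d ` W - {a})"
    by (rule span_redundant[OF a(2)])
  then have "span (lift d ` W) = span (lift d ` W - {a})"
    using a(1) by (simp add: insert_absorb)
  then have "unit_point ` {..<Suc d} \<subseteq> span (lift d ` W - {a})"
    using span_lift_general_position[OF assms] by (auto simp: in_Rn_iff lookup_single when_def)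
  then have "card (unit_point ` {..<Suc d}) \<le> card (lift d ` W - {a})"
    using independent_span_bound[of "lift d ` W - {a}"] finW independent_unit_points by blast
  moreover have "card (lift d ` W) \<le> d + 1" using card_image_le[OF finW, of "lift d"] W(2) by simp
  ultimately show False using a(1) finW by (simp add: card_unit_points)
qed

section \<open>Relative interiors of simplices\<close>

lemma dist_lookup_le: "dist (Poly_Mapping.lookup x j) (Poly_Mapping.lookup y j) \<le> dist x (y :: point)"
proof (cases "j \<in> Poly_Mapping.keys x \<union> Poly_Mapping.keys y")
  case True
  then show ?thesis
    unfolding dist_poly_mapping_def
    by (intro member_le_sum[of j _ "\<lambda>n. dist (Poly_Mapping.lookup x n) (Poly_Mapping.lookup y n)"]) auto
next
  case False
  then show ?thesis by (simp add: in_keys_iff)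
qed

lemma continuous_on_lookup: "continuous_on A (\<lambda>x :: point. Poly_Mapping.lookup x j)"
  unfolding continuous_on_iff using dist_lookup_le by (meson le_less_trans)

text \<open>The barycentric coordinates extend to continuous functions on the whole space. The open
  set where all are positive meets the affine hull inside the simplex.\<close>

lemma positive_combination_in_rel_interior:
  assumes A: "finite A" "A \<subseteq> Rn d" "independent (lift d ` A)"
    and u: "\<And>v. v \<in> A \<Longrightarrow> 0 < u v" "sum u A = 1"
  shows "(\<Sum>v\<in>A. u v *\<^sub>R v) \<in> rel_interior (convex hull A)"
proof -
  have "\<exists>g. linear g \<and> (\<forall>w\<in>A. g (lift d w) = (if w = v then 1 else 0 :: real))" for v
  proof -
    obtain g :: "point \<Rightarrow> real" where "linear g"
      "\<forall>x\<in>lift d ` A. g x = (if x = lift d v then 1 else 0)"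
      using linear_independent_extend[OF A(3), of "\<lambda>x. if x = lift d v then 1 else 0"] by blast
    then show ?thesis using inj_lift by (intro exI[of _ g]) (auto dest: injD)
  qed
  then obtain g where lin: "\<And>v. linear (g v)"
    and g: "\<And>v w. w \<in> A \<Longrightarrow> g v (lift d w) = (if w = v then 1 else 0 :: real)"
    by metis
  \<comment> \<open>The functional \<open>g v\<close> lives on an infinite-dimensional space and
    need not be continuous. The function \<open>?h v\<close> involves finitely many coordinates,
    hence is continuous, and equals \<open>g v (lift d y)\<close> for \<open>y\<close> in
    \<open>Rn d\<close>.\<close>
  let ?h = "\<lambda>v y. (\<Sum>j<d. Poly_Mapping.lookup y j * g v (unit_point j)) + g v (unit_point d)"
  have h: "?h v (\<Sum>w\<in>A. c w *\<^sub>R w) = c v" if c: "sum c A = 1" and v: "v \<in> A" for c v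
  proof -
    let ?y = "\<Sum>w\<in>A. c w *\<^sub>R w"
    have "?y \<in> Rn d" using A(2) by (intro sum_scaleR_in_Rn) auto
    then have "?h v ?y = g v ?y + g v (unit_point d)" using linear_on_Rn[OF lin] by simp
    also have "\<dots> = g v (\<Sum>w\<in>A. c w *\<^sub>R lift d w)"
      using sum_scaleR_lift[of c d "\<lambda>w. w" A] c by (simp add: linear_add[OF lin])
    also have "\<dots> = (\<Sum>w\<in>A. c w * g v (lift d w))"
      by (simp add: linear_sum[OF lin] linear_cmul[OF lin])
    also have "\<dots> = (\<Sum>w\<in>A. if w = v then c w else 0)"
      by (rule sum.cong) (auto simp: g)
    also have "\<dots> = c v" using v A(1) by simp
    finally show ?thesis .
  qed
  let ?T = "\<Inter>v\<in>A. {y. 0 < ?h v y}"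
  have "open ?T"
    using A(1) by (intro open_INT ballI open_Collect_less continuous_intros continuous_on_lookup)
  moreover have "(\<Sum>v\<in>A. u v *\<^sub>R v) \<in> ?T" using h[OF u(2)] u(1) by simp
  moreover have "(\<Sum>v\<in>A. u v *\<^sub>R v) \<in> convex hull A"
    unfolding convex_hull_finite[OF A(1)] using u by (auto intro!: exI[of _ u] less_imp_le)
  moreover have "?T \<inter> affine hull (convex hull A) \<subseteq> convex hull A"
  proof
    fix y assume y: "y \<in> ?T \<inter> affine hull (convex hull A)"
    then have "y \<in> affine hull A" by simp
    then obtain c where c: "sum c A = 1" "y = (\<Sum>v\<in>A. c v *\<^sub>R v)"
      unfolding affine_hull_finite[OF A(1)] by blast
    have "0 \<le> c v" if "v \<in> A" for v using y h[OF c(1) that] that unfolding c(2) by fastforce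
    then show "y \<in> convex hull A"
      unfolding convex_hull_finite[OF A(1)] using c by blast
  qed
  ultimately show ?thesis unfolding mem_rel_interior by blast
qed

section \<open>From affine dependencies to crossing pairs\<close>

definition affine_dependencies :: "nat \<Rightarrow> (nat \<Rightarrow> point) \<Rightarrow> (nat \<Rightarrow> real) set" where
  "affine_dependencies d p = {x. (\<Sum>i<2 * d. x i) = 0 \<and> (\<Sum>i<2 * d. x i *\<^sub>R p i) = 0}"

lemma affine_dependencies_lift:
  assumes "\<And>i. i < 2 * d \<Longrightarrow> p i \<in> Rn d"
  shows "x \<in> affine_dependencies d p \<longleftrightarrow> (\<Sum>i<2 * d. x i *\<^sub>R lift d (p i)) = 0"
proof
  assume "(\<Sum>i<2 * d. x i *\<^sub>R lift d (p i)) = 0"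
  then have 0: "(\<Sum>i<2 * d. x i *\<^sub>R p i) + (\<Sum>i<2 * d. x i) *\<^sub>R unit_point d = 0"
    by (simp add: sum_scaleR_lift)
  have "(\<Sum>i<2 * d. x i *\<^sub>R p i) \<in> Rn d" by (rule sum_scaleR_in_Rn) (use assms in auto)
  then have "(\<Sum>i<2 * d. x i) = 0"
    using arg_cong[OF 0, of "\<lambda>y. Poly_Mapping.lookup y d"]
    by (simp add: lookup_add lookup_scaleR in_Rn_iff)
  then show "x \<in> affine_dependencies d p" using 0 by (simp add: affine_dependencies_def)
qed (simp add: affine_dependencies_def sum_scaleR_lift)

text \<open>The \<open>d + 1\<close> lifts outside \<open>Z\<close> form a basis of
  \<open>Rn (Suc d)\<close>: spanning lets any values on \<open>Z\<close> be completed to a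
  dependency, independence makes the completion unique.\<close>

lemma generic_subspace_affine_dependencies:
  assumes d: "3 \<le> d" and dr: "rectilinear_drawing d {..<2 * d} p"
  shows "generic_subspace d (affine_dependencies d p)"
proof
  let ?n = "{..<2 * d}" and ?q = "\<lambda>i. lift d (p i)"
  have inj: "inj_on p ?n" and gp: "general_position d (p ` ?n)"
    using dr by (auto simp: rectilinear_drawing_def)
  have pR: "p i \<in> Rn d" if "i < 2 * d" for i using gp that by (auto simp: general_position_def)
  have mem: "x \<in> affine_dependencies d p \<longleftrightarrow> (\<Sum>i<2 * d. x i *\<^sub>R ?q i) = 0" for x
    by (rule affine_dependencies_lift) (rule pR)
  have injq: "inj_on ?q ?n" using inj inj_lift by (auto simp: inj_on_def dest: injD)
  have compl: "card (?n - Z) = d + 1" if "Z \<subseteq> ?n" "card Z = d - 1" for Z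
    using that d by (subst card_Diff_subset) (auto intro: finite_subset)
  have W: "p ` W \<subseteq> p ` ?n" "card (p ` W) = d + 1" if "W \<subseteq> ?n" "card W = d + 1" for W
    using that card_image[OF inj_on_subset[OF inj that(1)]] by auto
  show "3 \<le> d" by (rule d)
  show "(\<lambda>i. a * x i + b * y i) \<in> affine_dependencies d p"
    if "x \<in> affine_dependencies d p" "y \<in> affine_dependencies d p" for x y a b
    using that
    by (simp add: affine_dependencies_def sum.distrib scaleR_add_left
        flip: sum_distrib_left scaleR_scaleR scaleR_sum_right)
  show "\<exists>x\<in>affine_dependencies d p. \<forall>i\<in>Z. x i = v i" if Z: "Z \<subseteq> ?n" "card Z = d - 1" for Z v
  proof -
    let ?W = "?n - Z"
    have "- (\<Sum>i\<in>Z. v i *\<^sub>R ?q i) = (\<Sum>i\<in>Z. (- v i) *\<^sub>R ?q i)" by (simp add: sum_negf)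
    also have "\<dots> \<in> Rn (Suc d)" by (rule sum_scaleR_in_Rn) (use Z pR lift_in_Rn in auto)
    finally have "- (\<Sum>i\<in>Z. v i *\<^sub>R ?q i) \<in> span (lift d ` p ` ?W)"
      using span_lift_general_position[OF gp W[of ?W]] compl[OF Z] by auto
    then obtain u where "(\<Sum>y\<in>lift d ` p ` ?W. u y *\<^sub>R y) = - (\<Sum>i\<in>Z. v i *\<^sub>R ?q i)"
      by (auto simp: span_finite)
    moreover have "(\<Sum>y\<in>lift d ` p ` ?W. u y *\<^sub>R y) = (\<Sum>i\<in>?W. u (?q i) *\<^sub>R ?q i)"
      unfolding image_image by (subst sum.reindex) (use injq in \<open>auto intro: inj_on_subset\<close>)
    ultimately have uv: "(\<Sum>i\<in>?W. u (?q i) *\<^sub>R ?q i) = - (\<Sum>i\<in>Z. v i *\<^sub>R ?q i)" by simp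
    let ?x = "\<lambda>i. if i \<in> Z then v i else u (?q i)"
    have "(\<Sum>i<2 * d. ?x i *\<^sub>R ?q i) = (\<Sum>i\<in>?W. ?x i *\<^sub>R ?q i) + (\<Sum>i\<in>Z. ?x i *\<^sub>R ?q i)"
      by (rule sum.subset_diff) (use Z in auto)
    also have "\<dots> = (\<Sum>i\<in>?W. u (?q i) *\<^sub>R ?q i) + (\<Sum>i\<in>Z. v i *\<^sub>R ?q i)"
      by (intro arg_cong2[of _ _ _ _ "(+)"] sum.cong) auto
    also have "\<dots> = 0" using uv by simp
    finally have "?x \<in> affine_dependencies d p" using mem by blast
    then show ?thesis by (intro bexI[of _ ?x]) auto
  qed
  show "x i = 0" if x: "x \<in> affine_dependencies d p" and Z: "Z \<subseteq> ?n" "card Z = d - 1"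
    and x0: "\<forall>i\<in>Z. x i = 0" and i: "i < 2 * d" for x Z i
  proof (cases "i \<in> Z")
    case False
    let ?W = "?n - Z"
    have injW: "inj_on ?q ?W" by (rule inj_on_subset[OF injq]) auto
    have inv: "the_inv_into ?W ?q (?q k) = k" if "k \<in> ?W" for k
      by (rule the_inv_into_f_f[OF injW that])
    have "0 = (\<Sum>i<2 * d. x i *\<^sub>R ?q i)" using x mem by simp
    also have "\<dots> = (\<Sum>i\<in>?W. x i *\<^sub>R ?q i) + (\<Sum>i\<in>Z. x i *\<^sub>R ?q i)"
      by (rule sum.subset_diff) (use Z in auto)
    also have "\<dots> = (\<Sum>i\<in>?W. x i *\<^sub>R ?q i)" using x0 by simp
    also have "\<dots> = (\<Sum>y\<in>?q ` ?W. x (the_inv_into ?W ?q y) *\<^sub>R y)"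
      unfolding sum.reindex[OF injW] o_def by (rule sum.cong[OF refl]) (simp only: inv)
    finally have s: "(\<Sum>y\<in>?q ` ?W. x (the_inv_into ?W ?q y) *\<^sub>R y) = 0" by simp
    have ind: "independent (?q ` ?W)"
      using independent_lift_general_position[OF gp W[of ?W]] compl[OF Z] by (auto simp: image_image)
    have iW: "i \<in> ?W" using i False by simp
    have "x (the_inv_into ?W ?q (?q i)) = 0"
      by (rule independentD[OF ind _ _ s]) (use iW in auto)
    then show ?thesis using inv[OF iW] by simp
  qed (use x0 in auto)
qed

text \<open>Moving the negative terms to the other side and dividing by the common sum
  \<open>s\<close> writes one point as a strictly positive convex combination of both vertex
  sets.\<close>

lemma crossing_of_affine_dependency:
  assumes dr: "rectilinear_drawing d {..<2 * d} p"
    and S: "S \<subseteq> {..<2 * d}" "card S = d" "0 < d"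
    and x: "x \<in> affine_dependencies d p" "\<forall>i\<in>S. 0 < x i" "\<forall>i\<in>{..<2 * d} - S. x i < 0"
  shows "crossing p S ({..<2 * d} - S)"
proof -
  let ?n = "{..<2 * d}"
  let ?S' = "?n - S"
  have inj: "inj_on p ?n" and gp: "general_position d (p ` ?n)"
    using dr by (auto simp: rectilinear_drawing_def)
  have pR: "p i \<in> Rn d" if "i < 2 * d" for i using gp that by (auto simp: general_position_def)
  have finS: "finite S" using S finite_subset by blast
  have split: "(\<Sum>i<2 * d. f i) = sum f ?S' + sum f S" for f :: "nat \<Rightarrow> 'b :: comm_monoid_add"
    by (rule sum.subset_diff) (use S in auto)
  define s where "s = (\<Sum>i\<in>S. x i)"
  have "S \<noteq> {}" using S by auto
  then have s: "0 < s" unfolding s_def using x finS by (intro sum_pos) auto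
  have s': "(\<Sum>i\<in>?S'. - x i) = s"
    using x(1) split[of x] by (simp add: affine_dependencies_def s_def sum_negf)
  have eq: "(\<Sum>i\<in>?S'. (- x i / s) *\<^sub>R p i) = (\<Sum>i\<in>S. (x i / s) *\<^sub>R p i)"
  proof -
    have "(\<Sum>i\<in>?S'. x i *\<^sub>R p i) + (\<Sum>i\<in>S. x i *\<^sub>R p i) = 0"
      using x(1) split[of "\<lambda>i. x i *\<^sub>R p i"] by (simp add: affine_dependencies_def)
    then have "(\<Sum>i\<in>S. x i *\<^sub>R p i) = (\<Sum>i\<in>?S'. (- x i) *\<^sub>R p i)"
      by (simp add: sum_negf add_eq_0_iff)
    then have "(1 / s) *\<^sub>R (\<Sum>i\<in>S. x i *\<^sub>R p i) = (1 / s) *\<^sub>R (\<Sum>i\<in>?S'. (- x i) *\<^sub>R p i)" by simp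
    then show ?thesis unfolding scaleR_sum_right by simp
  qed
  have inside: "(\<Sum>i\<in>e. u i *\<^sub>R p i) \<in> rel_interior (simplex_of p e)"
    if e: "e \<subseteq> ?n" "card e = d" and u: "\<forall>i\<in>e. 0 < u i" "(\<Sum>i\<in>e. u i) = 1" for e and u :: "nat \<Rightarrow> real"
  proof -
    have fe: "finite e" using e finite_subset by blast
    have "card (?n - e) = d" using e fe by (subst card_Diff_subset) auto
    then have "?n - e \<noteq> {}" using S by (metis card.empty less_irrefl)
    \<comment> \<open>Independence is available for sets of \<open>d + 1\<close> points, so one more
      vertex is added to \<open>e\<close> and then dropped.\<close>
    then obtain k where k: "k \<in> ?n - e" by blast
    have inje: "inj_on p e" using inj e inj_on_subset by blast
    have "card (insert k e) = d + 1" using e k fe by simp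
    then have "card (p ` insert k e) = d + 1"
      using e k by (subst card_image[OF inj_on_subset[OF inj]]) auto
    then have "independent (lift d ` p ` insert k e)"
      using independent_lift_general_position[OF gp, of "p ` insert k e"] e k by blast
    then have ind: "independent (lift d ` p ` e)" by (rule independent_mono) auto
    let ?v = "\<lambda>y. u (the_inv_into e p y)"
    have "(\<Sum>y\<in>p ` e. ?v y *\<^sub>R y) \<in> rel_interior (convex hull (p ` e))"
    proof (rule positive_combination_in_rel_interior[OF _ _ ind])
      show "0 < ?v y" if "y \<in> p ` e" for y
        using that u(1) the_inv_into_f_f[OF inje] by auto
      show "sum ?v (p ` e) = 1"
        by (subst sum.reindex[OF inje]) (simp add: the_inv_into_f_f[OF inje] u(2) cong: sum.cong)
    qed (use fe e pR in auto)
    moreover have "(\<Sum>y\<in>p ` e. ?v y *\<^sub>R y) = (\<Sum>i\<in>e. u i *\<^sub>R p i)"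
      by (subst sum.reindex[OF inje]) (simp add: the_inv_into_f_f[OF inje] cong: sum.cong)
    ultimately show ?thesis by (simp add: simplex_of_def)
  qed
  have "(\<Sum>i\<in>S. (x i / s) *\<^sub>R p i) \<in> rel_interior (simplex_of p S)"
    by (rule inside) (use S x s in \<open>auto simp: s_def simp flip: sum_divide_distrib\<close>)
  moreover have "(\<Sum>i\<in>?S'. (- x i / s) *\<^sub>R p i) \<in> rel_interior (simplex_of p ?S')"
  proof (rule inside)
    show "card ?S' = d" using S finS by (subst card_Diff_subset) auto
    show "\<forall>i\<in>?S'. 0 < - x i / s" using x(3) s by (auto intro: divide_neg_pos)
    show "(\<Sum>i\<in>?S'. - x i / s) = 1" using s' s unfolding sum_divide_distrib[symmetric] by simp
  qed auto
  ultimately show ?thesis unfolding crossing_def eq by blast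
qed

text \<open>Each cell forms a crossing pair with its complement, and a pair contains at most two
  cells.\<close>

lemma card_cells_le_crossing_pairs:
  assumes d: "3 \<le> d" and dr: "rectilinear_drawing d {..<2 * d} p"
  shows "card (generic_subspace.cells d (affine_dependencies d p))
    \<le> 2 * card (crossing_pairs d {..<2 * d} p)"
proof -
  interpret generic_subspace d "affine_dependencies d p"
    by (rule generic_subspace_affine_dependencies[OF assms])
  let ?CP = "crossing_pairs d {..<2 * d} p"
  have "?CP \<subseteq> Pow (Pow {..<2 * d})"
    by (auto simp: crossing_pairs_def complete_hyperedges_def)
  then have fin: "finite ?CP" by (rule finite_subset) simp
  have "cells \<subseteq> \<Union>?CP"
  proof
    fix S assume "S \<in> cells"
    then obtain x where S: "S \<subseteq> {..<2 * d}" "card S = d" and x: "x \<in> affine_dependencies d p"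
      "\<forall>i\<in>S. 0 < x i" "\<forall>i\<in>{..<2 * d} - S. x i < 0"
      unfolding cells_def by blast
    have "crossing p S ({..<2 * d} - S)"
      by (rule crossing_of_affine_dependency[OF dr S _ x]) (use d in simp)
    moreover have "card ({..<2 * d} - S) = d"
      using S by (subst card_Diff_subset) (auto intro: finite_subset)
    ultimately have "{S, {..<2 * d} - S} \<in> ?CP"
      unfolding crossing_pairs_def complete_hyperedges_def using S by blast
    then show "S \<in> \<Union>?CP" by blast
  qed
  moreover have finU: "finite (\<Union>?CP)"
    using \<open>?CP \<subseteq> Pow (Pow {..<2 * d})\<close> by (intro finite_Union fin) (auto intro: finite_subset)
  ultimately have "card cells \<le> card (\<Union>?CP)" by (rule card_mono[rotated])
  also have "\<dots> \<le> (\<Sum>P\<in>?CP. card P)" by (rule card_Union_le_sum_card)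
  also have "\<dots> \<le> (\<Sum>P\<in>?CP. 2)"
  proof (rule sum_mono)
    fix P assume "P \<in> ?CP"
    then obtain e f where "P = {e, f}" by (auto simp: crossing_pairs_def)
    then show "card P \<le> 2" by (simp add: card_insert_if)
  qed
  finally show ?thesis by simp
qed

section \<open>The lower bound\<close>

lemma power2_le_central_binomial: "2 ^ n \<le> (n + 1) * (n choose (n div 2))"
proof -
  have "(2::nat) ^ n = (\<Sum>k\<le>n. n choose k)" by (simp add: choose_row_sum)
  also have "\<dots> \<le> (\<Sum>k\<le>n. n choose (n div 2))" by (intro sum_mono binomial_maximum)
  finally show ?thesis by simp
qed

text \<open>Consecutive coefficients have ratio \<open>(n - m) / (m + 1)\<close>, which is at least
  2 in the lower third of the row.\<close>

lemma binomial_doubling: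
  assumes "3 * (k + j) \<le> n"
  shows "2 ^ j * (n choose k) \<le> n choose (k + j)"
  using assms
proof (induction j)
  case (Suc j)
  let ?m = "k + j"
  have "Suc ?m * (n choose Suc ?m) = (n - ?m) * (n choose ?m)"
    by (metis binomial_absorb_comp binomial_absorption)
  moreover have "2 * Suc ?m \<le> n - ?m" using Suc.prems by simp
  ultimately have "2 * Suc ?m * (n choose ?m) \<le> Suc ?m * (n choose Suc ?m)"
    by (metis mult_le_mono1)
  then have "Suc ?m * (2 * (n choose ?m)) \<le> Suc ?m * (n choose Suc ?m)" by (simp only: ac_simps)
  then have "2 * (n choose ?m) \<le> n choose Suc ?m" by (simp only: Suc_mult_le_cancel1)
  moreover have "2 ^ j * (n choose k) \<le> n choose ?m" using Suc by simp
  ultimately show ?case by simp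
qed simp

lemma (in generic_subspace) card_small_sets:
  assumes "9 \<le> d"
  shows "2 ^ (d div 6) * card small_sets \<le> d * (2 * d choose (d - 3))"
proof -
  let ?h = "(d - 2) div 2"
  let ?C = "\<lambda>j. {N. N \<subseteq> {..<2 * d} \<and> card N = j}"
  have "small_sets = (\<Union>j\<le>?h. ?C j)" by (auto simp: small_sets_def)
  then have "card small_sets \<le> (\<Sum>j\<le>?h. card (?C j))" by (simp add: card_UN_le)
  also have "\<dots> = (\<Sum>j\<le>?h. 2 * d choose j)" using n_subsets[of "{..<2 * d}"] by simp
  also have "\<dots> \<le> (\<Sum>j\<le>?h. 2 * d choose ?h)"
    by (intro sum_mono binomial_mono) auto
  also have "\<dots> = Suc ?h * (2 * d choose ?h)" by simp
  also have "\<dots> \<le> d * (2 * d choose ?h)" using d_ge by (intro mult_right_mono) auto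
  finally have small: "card small_sets \<le> d * (2 * d choose ?h)" .
  \<comment> \<open>From about \<open>d / 2\<close>, there is room for \<open>d / 6\<close>
    doublings before reaching \<open>2 * d / 3\<close>, one third of the row.\<close>
  have "2 ^ (d div 6) * (2 * d choose ?h) \<le> 2 * d choose (?h + d div 6)"
    by (rule binomial_doubling) presburger
  also have "\<dots> \<le> 2 * d choose (d - 3)"
    by (rule binomial_mono) (use assms in linarith)+
  finally have big: "2 ^ (d div 6) * (2 * d choose ?h) \<le> 2 * d choose (d - 3)" .
  have "2 ^ (d div 6) * card small_sets \<le> 2 ^ (d div 6) * (d * (2 * d choose ?h))"
    by (intro mult_left_mono small) simp
  also have "\<dots> = d * (2 ^ (d div 6) * (2 * d choose ?h))" by simp
  also have "\<dots> \<le> d * (2 * d choose (d - 3))" by (intro mult_left_mono big) simp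
  finally show ?thesis .
qed

text \<open>The coefficient \<open>?b\<close> bounds \<open>small_sets\<close> from above and the
  incidences from below, so it cancels and only polynomial losses remain against
  \<open>2 ^ (d div 6)\<close>.\<close>

lemma crossing_pairs_exponential:
  assumes d: "9 \<le> d" and dr: "rectilinear_drawing d {..<2 * d} p"
  shows "2 ^ (d - 2) * 2 ^ (d div 6) \<le> 16 * d ^ 5 * card (crossing_pairs d {..<2 * d} p)"
proof -
  interpret generic_subspace d "affine_dependencies d p"
    by (rule generic_subspace_affine_dependencies[OF _ dr]) (use d in simp)
  let ?c = "(d - 2) choose ((d - 2) div 2)" and ?b = "2 * d choose (d - 3)"
  let ?CP = "card (crossing_pairs d {..<2 * d} p)"
  have cells: "card cells \<le> 2 * ?CP" by (rule card_cells_le_crossing_pairs[OF _ dr]) (use d in simp)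
  have central: "2 ^ (d - 2) \<le> d * ?c"
  proof -
    have "2 ^ (d - 2) \<le> (d - 2 + 1) * ?c" by (rule power2_le_central_binomial)
    also have "\<dots> \<le> d * ?c" using d by (intro mult_right_mono) auto
    finally show ?thesis .
  qed
  have "?b * (2 ^ (d - 2) * 2 ^ (d div 6)) \<le> ?b * (d * ?c * 2 ^ (d div 6))"
    using central by simp
  also have "\<dots> = d * 2 ^ (d div 6) * (?b * ?c)" by simp
  also have "\<dots> \<le> d * 2 ^ (d div 6) * (card cells * (8 * d ^ 2 * card small_sets) * (d - 2))"
    by (intro mult_left_mono cells_lower_bound) simp
  also have "\<dots> = 8 * d ^ 3 * (d - 2) * card cells * (2 ^ (d div 6) * card small_sets)"
    by (simp add: power_numeral_reduce ac_simps)
  also have "\<dots> \<le> 8 * d ^ 3 * (d - 2) * card cells * (d * ?b)"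
    by (intro mult_left_mono card_small_sets d) simp
  also have "\<dots> \<le> 8 * d ^ 3 * d * (2 * ?CP) * (d * ?b)"
    by (intro mult_mono cells) auto
  also have "\<dots> = ?b * (16 * d ^ 5 * ?CP)" by (simp add: power_numeral_reduce ac_simps)
  finally have "?b * (2 ^ (d - 2) * 2 ^ (d div 6)) \<le> ?b * (16 * d ^ 5 * ?CP)" .
  moreover have "0 < ?b" by simp
  ultimately show ?thesis by simp
qed

theorem theorem2:
  shows "\<exists>c::real. c > 0 \<and> (\<exists>d0::nat. \<forall>d\<ge>d0. \<forall>p :: nat \<Rightarrow> point.
           rectilinear_drawing d {..<2 * d} p \<longrightarrow>
           \<not> convex_position (p ` {..<2 * d}) \<longrightarrow>
           real (card (crossing_pairs d {..<2 * d} p)) \<ge> c * 2 ^ d * real d powr (3 / 2))"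
proof -
  \<comment> \<open>Here 128 is the product of 16 from the exponential bound, 4 from
    \<open>2 ^ d = 4 * 2 ^ (d - 2)\<close>, and 2 from rounding \<open>d / 6\<close> down; the
    constant \<open>c = 1\<close> then suffices.\<close>
  have "eventually (\<lambda>d::nat. real d powr (3 / 2) * real d ^ 5 * 128 \<le> 2 powr (real d / 6)) at_top"
    by real_asymp
  then obtain d1 where d1: "\<And>d::nat. d \<ge> d1 \<Longrightarrow>
      real d powr (3 / 2) * real d ^ 5 * 128 \<le> 2 powr (real d / 6)"
    unfolding eventually_at_top_linorder by blast
  have "real (card (crossing_pairs d {..<2 * d} p)) \<ge> 1 * 2 ^ d * real d powr (3 / 2)"
    if d: "d \<ge> max d1 9" and dr: "rectilinear_drawing d {..<2 * d} p" for d p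
  proof -
    let ?CP = "real (card (crossing_pairs d {..<2 * d} p))"
    have "real d / 6 \<le> real (d div 6) + 1" by linarith
    then have "2 powr (real d / 6) \<le> 2 powr (real (d div 6) + 1)" by simp
    also have "\<dots> = 2 * 2 ^ (d div 6)" by (simp add: powr_add powr_realpow)
    finally have h: "real d powr (3 / 2) * real d ^ 5 * 128 \<le> 2 * 2 ^ (d div 6)"
      using d1[of d] d by linarith
    have "real (2 ^ (d - 2) * 2 ^ (d div 6)) \<le> real (16 * d ^ 5 * card (crossing_pairs d {..<2 * d} p))"
      using crossing_pairs_exponential[OF _ dr] d by (intro of_nat_mono) simp
    then have e: "2 ^ (d - 2) * 2 ^ (d div 6) \<le> 16 * real d ^ 5 * ?CP" by simp
    have p2: "(2::real) ^ d = 4 * 2 ^ (d - 2)"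
    proof -
      have "(2::real) ^ (2 + (d - 2)) = 4 * 2 ^ (d - 2)" by (simp only: power_add) simp
      moreover have "2 + (d - 2) = d" using d by linarith
      ultimately show ?thesis by metis
    qed
    have "2 ^ (d - 2) * (real d powr (3 / 2) * real d ^ 5 * 128) \<le> 2 ^ (d - 2) * (2 * 2 ^ (d div 6))"
      using h by (intro mult_left_mono) auto
    also have "\<dots> \<le> 2 * (16 * real d ^ 5 * ?CP)" using e by simp
    finally have "real d ^ 5 * 32 * (2 ^ d * real d powr (3 / 2)) \<le> real d ^ 5 * 32 * ?CP"
      unfolding p2 by (simp add: algebra_simps)
    then show ?thesis using d by simp
  qed
  then show ?thesis by (intro exI[of _ 1] conjI exI[of _ "max d1 9"]) auto
qed

end
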